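(* Let $X$ be a connected compactly generated space and let $\mathbf{F}$ be a $1$-independent normed space of continuous functions over $X$. Let $\omega:X\to\mathbb{C}$ be such that the multiplication operator $M_{\omega}$ is unitary on $\mathbf{F}$. Then there is $\lambda\in\mathbb{C}$ with $|\lambda|=1$ such that $\omega(x)=\lambda$ for all $x\in X$, provided that one of the following conditions is satisfied: (i) $\mathbf{F}$ is compactly embedded; (ii) $\mathbf{F}$ is weakly compactly embedded and nearly strictly convex, and the closed unit ball $\overline{B}_{\mathbf{F}}$ is closed in $\mathcal{C}(X)$; (iii) $\mathbf{F}$ is weakly compactly embedded and $\mathbf{F}^{**}$ is nearly strictly convex; (iv) $\mathbf{F}$ is reflexive and nearly strictly convex.
   Context: All spaces are over $\mathbb{C}$. A Hausdorff topological space $X$ is compactly generated (a k-space) if every subset of $X$ having closed intersection with every compact subset of $X$ is closed. $\mathcal{C}(X)$ is the space of all continuous functions $X\to\mathbb{C}$ with the compact-open topology. A normed space of continuous functions (NSCF) over $X$ is a linear subspace $\mathbf{F}\subset\mathcal{C}(X)$ equipped with a norm (not necessarily complete) such that the inclusion $J_{\mathbf{F}}:\mathbf{F}\to\mathcal{C}(X)$ is continuous. $B_{\mathbf{F}}$ and $\overline{B}_{\mathbf{F}}$ are the open and closed unit balls of $\mathbf{F}$. $\mathbf{F}$ is (weakly) compactly embedded if $B_{\mathbf{F}}$ is (weakly) relatively compact in $\mathcal{C}(X)$. $\mathbf{F}$ is $1$-independent if for every $x\in X$ there is $f\in\mathbf{F}$ with $f(x)\neq 0$. For $\omega:X\to\mathbb{C}$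 the multiplication operator is $[M_{\omega}f](x)=\omega(x)f(x)$; "$M_{\omega}$ is unitary on $\mathbf{F}$" means that $M_{\omega}$ maps $\mathbf{F}$ into $\mathbf{F}$ and is a surjective linear isometry of $\mathbf{F}$. A normed space $F$ is nearly strictly convex if every convex subset of its unit sphere is precompact (totally bounded) in $F$. *)

theory Defs
  imports "HOL-Analysis.Analysis" "HOL-Library.Function_Algebras"
begin

text \<open>
  Every vector space here is a space of complex-valued functions with pointwise operations:
  \<open>\<C>(X)\<close> and its subspaces consist of functions on \<open>X\<close>, and the dual of a space of functions
  \<open>'b \<Rightarrow> complex\<close> consists of functions \<open>('b \<Rightarrow> complex) \<Rightarrow> complex\<close>. So duals can be iterated
  within one family of definitions. The additive structure is that of
  \<^theory>\<open>HOL-Library.Function_Algebras\<close>.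
\<close>

definition scaleF :: "complex \<Rightarrow> ('b \<Rightarrow> complex) \<Rightarrow> 'b \<Rightarrow> complex"  (infixr "*\<^sub>F" 75)
  where "c *\<^sub>F f = (\<lambda>x. c * f x)"

global_interpretation complex_fun: vector_space "scaleF :: complex \<Rightarrow> ('b \<Rightarrow> complex) \<Rightarrow> _"
  by unfold_locales (simp_all add: scaleF_def fun_eq_iff algebra_simps)

text \<open>The relations below constrain maps and norms only on a carrier set \<open>V\<close>, not on the whole type.\<close>

definition linear_on ::
  "(complex \<Rightarrow> 'v \<Rightarrow> 'v) \<Rightarrow> (complex \<Rightarrow> 'w \<Rightarrow> 'w) \<Rightarrow> 'v::plus set \<Rightarrow> ('v \<Rightarrow> 'w::plus) \<Rightarrow> bool"
  where "linear_on s t V T \<longleftrightarrow>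
    (\<forall>f\<in>V. \<forall>g\<in>V. T (f + g) = T f + T g) \<and> (\<forall>c. \<forall>f\<in>V. T (s c f) = t c (T f))"

definition normed_space_on :: "('b \<Rightarrow> complex) set \<Rightarrow> (('b \<Rightarrow> complex) \<Rightarrow> real) \<Rightarrow> bool"
  where "normed_space_on V N \<longleftrightarrow>
    complex_fun.subspace V \<and>
    (\<forall>f\<in>V. 0 \<le> N f) \<and>
    (\<forall>f\<in>V. N f = 0 \<longleftrightarrow> f = 0) \<and>
    (\<forall>c. \<forall>f\<in>V. N (c *\<^sub>F f) = cmod c * N f) \<and>
    (\<forall>f\<in>V. \<forall>g\<in>V. N (f + g) \<le> N f + N g)"

text \<open>The value \<open>0\<close> off \<open>V\<close> is needed because \<^locale>\<open>Metric_space\<close> requires symmetry and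
  nonnegativity on the whole type.\<close>

definition dist_on :: "('b \<Rightarrow> complex) set \<Rightarrow> (('b \<Rightarrow> complex) \<Rightarrow> real) \<Rightarrow>
    ('b \<Rightarrow> complex) \<Rightarrow> ('b \<Rightarrow> complex) \<Rightarrow> real"
  where "dist_on V N f g = (if f \<in> V \<and> g \<in> V then N (f - g) else 0)"

definition norm_topology ::
  "('b \<Rightarrow> complex) set \<Rightarrow> (('b \<Rightarrow> complex) \<Rightarrow> real) \<Rightarrow> ('b \<Rightarrow> complex) topology"
  where "norm_topology V N = Metric_space.mtopology V (dist_on V N)"

definition open_unit_ball :: "('b \<Rightarrow> complex) set \<Rightarrow> (('b \<Rightarrow> complex) \<Rightarrow> real) \<Rightarrow> ('b \<Rightarrow> complex) set"
  where "open_unit_ball V N = {f \<in> V. N f < 1}"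

definition closed_unit_ball :: "('b \<Rightarrow> complex) set \<Rightarrow> (('b \<Rightarrow> complex) \<Rightarrow> real) \<Rightarrow> ('b \<Rightarrow> complex) set"
  where "closed_unit_ball V N = {f \<in> V. N f \<le> 1}"

definition unit_sphere :: "('b \<Rightarrow> complex) set \<Rightarrow> (('b \<Rightarrow> complex) \<Rightarrow> real) \<Rightarrow> ('b \<Rightarrow> complex) set"
  where "unit_sphere V N = {f \<in> V. N f = 1}"

text \<open>Convexity is restated because the type \<^typ>\<open>'b \<Rightarrow> complex\<close> is not an instance of
  \<^class>\<open>real_vector\<close>.\<close>

definition convex_fun :: "('b \<Rightarrow> complex) set \<Rightarrow> bool"
  where "convex_fun S \<longleftrightarrow>
    (\<forall>f\<in>S. \<forall>g\<in>S. \<forall>u\<ge>0. \<forall>v\<ge>0. u + v = (1::real) \<longrightarrow> of_real u *\<^sub>F f + of_real v *\<^sub>F g \<in> S)"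

definition nearly_strictly_convex :: "('b \<Rightarrow> complex) set \<Rightarrow> (('b \<Rightarrow> complex) \<Rightarrow> real) \<Rightarrow> bool"
  where "nearly_strictly_convex V N \<longleftrightarrow>
    (\<forall>S. S \<subseteq> unit_sphere V N \<and> convex_fun S \<longrightarrow>
         Metric_space.mtotally_bounded V (dist_on V N) S)"

text \<open>A continuous functional on a space with topology \<open>T\<close> is represented by its unique extension
  by \<open>0\<close> off \<open>topspace T\<close>, so that distinct elements are distinct functionals on \<open>topspace T\<close>.\<close>

definition continuous_dual :: "('b \<Rightarrow> complex) topology \<Rightarrow> (('b \<Rightarrow> complex) \<Rightarrow> complex) set"
  where "continuous_dual T =
    {\<phi>. linear_on (*\<^sub>F) (*) (topspace T) \<phi> \<and> continuous_map T euclidean \<phi> \<and>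
        (\<forall>f. f \<notin> topspace T \<longrightarrow> \<phi> f = 0)}"

definition weak_topology :: "('b \<Rightarrow> complex) topology \<Rightarrow> ('b \<Rightarrow> complex) topology"
  where "weak_topology T =
    topology_generated_by {{f \<in> topspace T. \<phi> f \<in> U} |\<phi> U. \<phi> \<in> continuous_dual T \<and> open U}"

definition dual_space ::
  "('b \<Rightarrow> complex) set \<Rightarrow> (('b \<Rightarrow> complex) \<Rightarrow> real) \<Rightarrow> (('b \<Rightarrow> complex) \<Rightarrow> complex) set"
  where "dual_space V N = continuous_dual (norm_topology V N)"

definition dual_norm ::
  "('b \<Rightarrow> complex) set \<Rightarrow> (('b \<Rightarrow> complex) \<Rightarrow> real) \<Rightarrow> (('b \<Rightarrow> complex) \<Rightarrow> complex) \<Rightarrow> real"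
  where "dual_norm V N \<phi> = (SUP f \<in> closed_unit_ball V N. cmod (\<phi> f))"

definition bidual_space ::
  "('b \<Rightarrow> complex) set \<Rightarrow> (('b \<Rightarrow> complex) \<Rightarrow> real) \<Rightarrow> ((('b \<Rightarrow> complex) \<Rightarrow> complex) \<Rightarrow> complex) set"
  where "bidual_space V N = dual_space (dual_space V N) (dual_norm V N)"

definition bidual_norm ::
  "('b \<Rightarrow> complex) set \<Rightarrow> (('b \<Rightarrow> complex) \<Rightarrow> real) \<Rightarrow> ((('b \<Rightarrow> complex) \<Rightarrow> complex) \<Rightarrow> complex) \<Rightarrow> real"
  where "bidual_norm V N = dual_norm (dual_space V N) (dual_norm V N)"

definition canonical_embedding ::
  "('b \<Rightarrow> complex) set \<Rightarrow> (('b \<Rightarrow> complex) \<Rightarrow> real) \<Rightarrow> ('b \<Rightarrow> complex) \<Rightarrow>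
    (('b \<Rightarrow> complex) \<Rightarrow> complex) \<Rightarrow> complex"
  where "canonical_embedding V N f = (\<lambda>\<phi>. if \<phi> \<in> dual_space V N then \<phi> f else 0)"

definition reflexive_space :: "('b \<Rightarrow> complex) set \<Rightarrow> (('b \<Rightarrow> complex) \<Rightarrow> real) \<Rightarrow> bool"
  where "reflexive_space V N \<longleftrightarrow> canonical_embedding V N ` V = bidual_space V N"

definition continuous_functions :: "('a::topological_space \<Rightarrow> complex) set"
  where "continuous_functions = {f. continuous_on UNIV f}"

definition compact_open_topology :: "('a::topological_space \<Rightarrow> complex) topology"
  where "compact_open_topology =
    topology_generated_by {{f \<in> continuous_functions. f ` K \<subseteq> U} |K U. compact K \<and> open U}"

definition nscf :: "('a::t2_space \<Rightarrow> complex) set \<Rightarrow> (('a \<Rightarrow> complex) \<Rightarrow> real) \<Rightarrow> bool"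
  where "nscf F N \<longleftrightarrow>
    F \<subseteq> continuous_functions \<and> normed_space_on F N \<and>
    continuous_map (norm_topology F N) compact_open_topology (\<lambda>f. f)"

definition relatively_compact_in :: "'b topology \<Rightarrow> 'b set \<Rightarrow> bool"
  where "relatively_compact_in T S \<longleftrightarrow> S \<subseteq> topspace T \<and> compactin T (T closure_of S)"

definition compactly_embedded :: "('a::t2_space \<Rightarrow> complex) set \<Rightarrow> (('a \<Rightarrow> complex) \<Rightarrow> real) \<Rightarrow> bool"
  where "compactly_embedded F N \<longleftrightarrow> relatively_compact_in compact_open_topology (open_unit_ball F N)"

definition weakly_compactly_embedded ::
  "('a::t2_space \<Rightarrow> complex) set \<Rightarrow> (('a \<Rightarrow> complex) \<Rightarrow> real) \<Rightarrow> bool"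
  where "weakly_compactly_embedded F N \<longleftrightarrow>
    relatively_compact_in (weak_topology compact_open_topology) (open_unit_ball F N)"

definition one_independent :: "('a \<Rightarrow> complex) set \<Rightarrow> bool"
  where "one_independent F \<longleftrightarrow> (\<forall>x. \<exists>f\<in>F. f x \<noteq> 0)"

definition mult_op :: "('a \<Rightarrow> complex) \<Rightarrow> ('a \<Rightarrow> complex) \<Rightarrow> 'a \<Rightarrow> complex"
  where "mult_op \<omega> f = (\<lambda>x. \<omega> x * f x)"

definition unitary_on ::
  "('b \<Rightarrow> complex) set \<Rightarrow> (('b \<Rightarrow> complex) \<Rightarrow> real) \<Rightarrow> (('b \<Rightarrow> complex) \<Rightarrow> 'b \<Rightarrow> complex) \<Rightarrow> bool"
  where "unitary_on V N T \<longleftrightarrow>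
    linear_on (*\<^sub>F) (*\<^sub>F) V T \<and> T ` V = V \<and> (\<forall>f\<in>V. N (T f) = N f)"

lemma Metric_space_dist_on:
  assumes "normed_space_on V N"
  shows "Metric_space V (dist_on V N)"
proof -
  have V: "complex_fun.subspace V"
    and nonneg: "\<And>f. f \<in> V \<Longrightarrow> 0 \<le> N f"
    and zero: "\<And>f. f \<in> V \<Longrightarrow> N f = 0 \<longleftrightarrow> f = 0"
    and scale: "\<And>c f. f \<in> V \<Longrightarrow> N (c *\<^sub>F f) = cmod c * N f"
    and triangle: "\<And>f g. f \<in> V \<Longrightarrow> g \<in> V \<Longrightarrow> N (f + g) \<le> N f + N g"
    using assms unfolding normed_space_on_def by simp_all
  have sub: "f - g \<in> V" if "f \<in> V" "g \<in> V" for f g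
    using V that by (rule complex_fun.subspace_diff)
  have sym: "N (f - g) = N (g - f)" if "f \<in> V" "g \<in> V" for f g
  proof -
    have "(-1) *\<^sub>F (g - f) = f - g" by (rule ext) (simp add: scaleF_def)
    then show ?thesis using scale[OF sub[OF that(2,1)], of "-1"] by simp
  qed
  show ?thesis
  proof (rule Metric_space.intro)
    fix f g
    show "0 \<le> dist_on V N f g"
      unfolding dist_on_def using nonneg sub by simp
    show "dist_on V N f g = dist_on V N g f"
      unfolding dist_on_def using sym[of f g] by simp
  next
    fix f g assume "f \<in> V" "g \<in> V"
    then show "dist_on V N f g = 0 \<longleftrightarrow> f = g"
      unfolding dist_on_def using zero[OF sub, of f g] by simp
  next
    fix f g h assume "f \<in> V" "g \<in> V" "h \<in> V"
    then show "dist_on V N f h \<le> dist_on V N f g + dist_on V N g h"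
      unfolding dist_on_def using triangle[OF sub sub, of f g g h] by simp
  qed
qed

lemma topspace_norm_topology [simp]:
  "normed_space_on V N \<Longrightarrow> topspace (norm_topology V N) = V"
  by (simp add: norm_topology_def Metric_space.topspace_mtopology Metric_space_dist_on)

lemma topspace_compact_open_topology [simp]:
  "topspace compact_open_topology = continuous_functions"
proof -
  have "continuous_functions \<in> {{f \<in> continuous_functions. f ` K \<subseteq> U} |K U. compact K \<and> open U}"
    by (rule CollectI, rule exI[of _ "{}"], rule exI[of _ UNIV]) simp
  then show ?thesis
    unfolding compact_open_topology_def topology_generated_by_topspace
    by (intro equalityI Union_least Union_upper) auto
qed

lemma topspace_weak_topology [simp]: "topspace (weak_topology T) = topspace T"
proof -
  have "(\<lambda>_. 0) \<in> continuous_dual T"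
    by (simp add: continuous_dual_def linear_on_def)
  then have "topspace T \<in> {{f \<in> topspace T. \<phi> f \<in> U} |\<phi> U. \<phi> \<in> continuous_dual T \<and> open U}"
    by (intro CollectI exI[of _ "\<lambda>_. 0"] exI[of _ UNIV]) simp
  then show ?thesis
    unfolding weak_topology_def topology_generated_by_topspace
    by (intro equalityI Union_least Union_upper) auto
qed

end

theory Submission
  imports Defs
begin

text \<open>
  The idea is the mean ergodic theorem, applied to a multiplication operator. Unitarity forces
  \<open>\<bar>\<omega>\<bar> = 1\<close> everywhere: if \<open>f x \<noteq> 0\<close>, then the values of \<open>M\<^sub>\<omega>\<^sup>n f\<close> and \<open>M\<^sub>\<omega>\<^sup>-\<^sup>n f\<close> at \<open>x\<close> stay
  bounded as \<open>n\<close> varies. Fix a point \<open>y\<close> and let \<open>\<zeta> = \<omega> / \<omega> y\<close>. For \<open>f \<in> F\<close> the averages of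
  \<open>f, \<zeta> f, \<dots>, \<zeta>\<^sup>n f\<close> lie in \<open>F\<close>, have norm at most that of \<open>f\<close>, and converge pointwise, by the
  geometric sum, to the function that equals \<open>f\<close> on the level set \<open>E = {\<omega> = \<omega> y}\<close> and vanishes
  off \<open>E\<close>.

  Each of the four conditions contains a compactness property that makes such a pointwise limit
  continuous (\<open>continuous_cluster_point\<close>). If \<open>F\<close> is compactly or weakly compactly embedded, then
  the averages have a cluster point in \<open>\<C>(X)\<close>; if \<open>F\<close> is reflexive, they have a weak cluster point
  in \<open>F\<close> itself. Point evaluations are continuous for the topologies in question, so the cluster
  point must be the pointwise limit.

  Hence cutting off any \<open>f \<in> F\<close> to \<open>E\<close> leaves it continuous. As \<open>F\<close> has no common zero, this
  makes \<open>E\<close> both open and closed, and connectedness gives \<open>E = X\<close>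
  (\<open>unitary_multiplier_constant\<close>).
\<close>

section \<open>Cluster points of sequences in compact sets\<close>

text \<open>
  The closures of the tails have the finite intersection property, so some point of the compact
  set lies in all of them. A continuous map sends it into the closure of every tail of the image
  sequence, hence to the limit if there is one.
\<close>

lemma compactin_sequence_cluster_point:
  fixes a :: "nat \<Rightarrow> 'b"
  assumes K: "compactin T K" and a: "\<And>n. a n \<in> K"
  obtains g where "g \<in> K"
    "\<And>e L. continuous_map T euclidean e \<Longrightarrow> (\<lambda>n. e (a n)) \<longlonglongrightarrow> L \<Longrightarrow> e g = (L :: 'c::metric_space)"
proof -
  define C where "C n = T closure_of (a ` {n..})" for n
  have KT: "K \<subseteq> topspace T" using K by (rule compactin_subset_topspace)
  have aT: "a ` {n..} \<subseteq> topspace T" for n using a KT by auto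
  have aC: "a m \<in> C n" if "n \<le> m" for m n
    using closure_of_subset[OF aT, of n] that by (auto simp: C_def)
  have "K \<inter> \<Inter>(range C) \<noteq> {}"
  proof (rule K[unfolded compactin_fip, THEN conjunct2, rule_format])
    show "(\<forall>D\<in>range C. closedin T D) \<and> (\<forall>\<F>. finite \<F> \<and> \<F> \<subseteq> range C \<longrightarrow> K \<inter> \<Inter> \<F> \<noteq> {})"
    proof (intro conjI ballI allI impI)
      fix D assume "D \<in> range C"
      then show "closedin T D" by (auto simp: C_def)
    next
      fix \<F> assume "finite \<F> \<and> \<F> \<subseteq> range C"
      then obtain I where I: "finite I" "\<F> = C ` I" using finite_subset_image[of \<F> C UNIV] by auto
      then obtain m where "\<forall>i\<in>I. i \<le> m" using finite_nat_set_iff_bounded_le by auto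
      then have "a m \<in> K \<inter> \<Inter> \<F>" using aC a by (auto simp: I)
      then show "K \<inter> \<Inter> \<F> \<noteq> {}" by blast
    qed
  qed
  then obtain g where g: "g \<in> K" "\<And>n. g \<in> C n" by auto
  show thesis
  proof (rule that[OF g(1)])
    fix e :: "'b \<Rightarrow> 'c" and L
    assume e: "continuous_map T euclidean e" and lim: "(\<lambda>n. e (a n)) \<longlonglongrightarrow> L"
    have "dist (e g) L \<le> \<epsilon>" if "\<epsilon> > 0" for \<epsilon>
    proof -
      obtain n where n: "\<And>m. m \<ge> n \<Longrightarrow> dist (e (a m)) L < \<epsilon>"
        using lim \<open>\<epsilon> > 0\<close> unfolding lim_sequentially by blast
      have "e g \<in> closure (e ` a ` {n..})"
        using continuous_map_image_closure_subset[OF e, of "a ` {n..}"] g(2)[of n]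
        by (auto simp: C_def)
      also have "\<dots> \<subseteq> cball L \<epsilon>"
        using n by (intro closure_minimal) (auto simp: dist_commute less_imp_le)
      finally show ?thesis by (simp add: dist_commute)
    qed
    then show "e g = L" by (metis dense_ge dist_le_zero_iff)
  qed
qed

section \<open>Bounded functionals and the bidual\<close>

lemma scaleF_apply: "(c *\<^sub>F f) x = c * f x"
  by (simp add: scaleF_def)

context
  fixes V :: "('b \<Rightarrow> complex) set" and N :: "('b \<Rightarrow> complex) \<Rightarrow> real"
  assumes V: "normed_space_on V N"
begin

lemma nspace_subspace: "complex_fun.subspace V"
  using V by (simp add: normed_space_on_def)

lemma nspace_norm_nonneg: "f \<in> V \<Longrightarrow> 0 \<le> N f"
  using V by (simp add: normed_space_on_def)

lemma nspace_norm_eq_zero: "f \<in> V \<Longrightarrow> N f = 0 \<longleftrightarrow> f = 0"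
  using V by (simp add: normed_space_on_def)

lemma nspace_norm_scale: "f \<in> V \<Longrightarrow> N (c *\<^sub>F f) = cmod c * N f"
  using V by (simp add: normed_space_on_def)

lemma nspace_norm_triangle: "f \<in> V \<Longrightarrow> g \<in> V \<Longrightarrow> N (f + g) \<le> N f + N g"
  using V by (simp add: normed_space_on_def)

lemma nspace_zero_mem: "0 \<in> V"
  using nspace_subspace by (rule complex_fun.subspace_0)

lemma nspace_norm_zero: "N 0 = 0"
  using nspace_norm_eq_zero[OF nspace_zero_mem] by simp

lemma dual_add: "\<phi> \<in> dual_space V N \<Longrightarrow> f \<in> V \<Longrightarrow> g \<in> V \<Longrightarrow> \<phi> (f + g) = \<phi> f + \<phi> g"
  using V by (auto simp: dual_space_def continuous_dual_def linear_on_def)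

lemma dual_scale: "\<phi> \<in> dual_space V N \<Longrightarrow> f \<in> V \<Longrightarrow> \<phi> (c *\<^sub>F f) = c * \<phi> f"
  using V by (auto simp: dual_space_def continuous_dual_def linear_on_def)

lemma dual_off: "\<phi> \<in> dual_space V N \<Longrightarrow> f \<notin> V \<Longrightarrow> \<phi> f = 0"
  using V by (auto simp: dual_space_def continuous_dual_def)

lemma dual_zero: "\<phi> \<in> dual_space V N \<Longrightarrow> \<phi> 0 = 0"
  using dual_add[of \<phi> 0 0] nspace_zero_mem by simp

text \<open>
  The dual is defined by continuity in the norm topology. This lemma and \<open>dual_intro\<close> replace
  continuity by boundedness, so that membership in duals can be checked by estimates.
\<close>

lemma dual_bounded:
  assumes \<phi>: "\<phi> \<in> dual_space V N"
  obtains C where "C \<ge> 0" "\<And>f. f \<in> V \<Longrightarrow> cmod (\<phi> f) \<le> C * N f"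
proof -
  interpret Metric_space V "dist_on V N" using V by (rule Metric_space_dist_on)
  have cont: "continuous_map mtopology euclidean \<phi>"
    using \<phi> by (simp add: dual_space_def continuous_dual_def norm_topology_def)
  have "openin mtopology {f \<in> V. \<phi> f \<in> ball 0 1}"
    using openin_continuous_map_preimage[OF cont, of "ball 0 1"] by simp
  then obtain r where r: "r > 0" "mball 0 r \<subseteq> {f \<in> V. \<phi> f \<in> ball 0 1}"
    using nspace_zero_mem dual_zero[OF \<phi>] by (auto simp: openin_mtopology)
  have small: "cmod (\<phi> f) < 1" if "f \<in> V" "N f < r" for f
  proof -
    have "N (0 - f) = N f" using nspace_norm_scale[OF that(1), of "-1"]
      by (simp add: scaleF_def fun_diff_def zero_fun_def)
    then have "f \<in> mball 0 r" using that nspace_zero_mem by (simp add: dist_on_def)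
    then show ?thesis using r(2) by auto
  qed
  show thesis
  proof (rule that[of "2 / r"])
    show "0 \<le> 2 / r" using r(1) by simp
    fix f assume f: "f \<in> V"
    show "cmod (\<phi> f) \<le> 2 / r * N f"
    proof (cases "f = 0")
      case True
      then show ?thesis using dual_zero[OF \<phi>] nspace_norm_zero by simp
    next
      case False
      then have pos: "N f > 0" using nspace_norm_nonneg[OF f] nspace_norm_eq_zero[OF f] by simp
      \<comment> \<open>rescale \<open>f\<close> to norm \<open>r / 2\<close>, strictly inside the ball of radius \<open>r\<close>\<close>
      define c where "c = r / (2 * N f)"
      have c: "c > 0" using pos r(1) by (simp add: c_def)
      have "N (of_real c *\<^sub>F f) < r"
        using nspace_norm_scale[OF f] c pos r(1) by (simp add: c_def norm_divide norm_mult)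
      then have "cmod (\<phi> (of_real c *\<^sub>F f)) < 1"
        using f nspace_subspace by (intro small) (simp_all add: complex_fun.subspace_scale)
      then have "c * cmod (\<phi> f) < 1"
        using dual_scale[OF \<phi> f] c by (simp add: norm_mult)
      then show ?thesis using pos r(1) by (simp add: c_def field_simps)
    qed
  qed
qed

lemma dual_intro:
  assumes add: "\<And>f g. f \<in> V \<Longrightarrow> g \<in> V \<Longrightarrow> \<phi> (f + g) = \<phi> f + \<phi> g"
    and scale: "\<And>c f. f \<in> V \<Longrightarrow> \<phi> (c *\<^sub>F f) = c * \<phi> f"
    and off: "\<And>f. f \<notin> V \<Longrightarrow> \<phi> f = 0"
    and bound: "\<And>f. f \<in> V \<Longrightarrow> cmod (\<phi> f) \<le> C * N f"
  shows "\<phi> \<in> dual_space V N"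
proof -
  interpret Metric_space V "dist_on V N" using V by (rule Metric_space_dist_on)
  have diff: "\<phi> (f - g) = \<phi> f - \<phi> g" if "f \<in> V" "g \<in> V" for f g
    using add[OF complex_fun.subspace_diff[OF nspace_subspace that] that(2)] by simp
  have "continuous_map mtopology (Met_TC.mtopology :: complex topology) \<phi>"
    unfolding metric_continuous_map[OF Met_TC.Metric_space_axioms]
  proof (intro conjI ballI allI impI)
    fix f and \<epsilon> :: real assume f: "f \<in> V" and \<epsilon>: "\<epsilon> > 0"
    show "\<exists>\<delta>>0. \<forall>g. g \<in> V \<and> dist_on V N f g < \<delta> \<longrightarrow> dist (\<phi> f) (\<phi> g) < \<epsilon>"
    proof (intro exI conjI allI impI)
      show "0 < \<epsilon> / (\<bar>C\<bar> + 1)" using \<epsilon> by simp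
      fix g assume g: "g \<in> V \<and> dist_on V N f g < \<epsilon> / (\<bar>C\<bar> + 1)"
      then have fg: "f - g \<in> V" using f nspace_subspace complex_fun.subspace_diff by blast
      have "dist (\<phi> f) (\<phi> g) = cmod (\<phi> (f - g))"
        using diff f g by (simp add: dist_norm)
      also have "\<dots> \<le> C * N (f - g)" using bound fg by blast
      also have "\<dots> \<le> (\<bar>C\<bar> + 1) * N (f - g)"
        using nspace_norm_nonneg[OF fg] by (intro mult_right_mono) auto
      also have "\<dots> < \<epsilon>" using f g by (simp add: dist_on_def pos_less_divide_eq mult.commute split: if_splits)
      finally show "dist (\<phi> f) (\<phi> g) < \<epsilon>" .
    qed
  qed auto
  then show ?thesis
    using V add scale off
    by (auto simp: dual_space_def continuous_dual_def linear_on_def norm_topology_def)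
qed

lemma dual_norm_bdd:
  assumes "\<phi> \<in> dual_space V N"
  shows "bdd_above ((\<lambda>f. cmod (\<phi> f)) ` closed_unit_ball V N)"
proof -
  obtain C where C: "C \<ge> 0" "\<And>f. f \<in> V \<Longrightarrow> cmod (\<phi> f) \<le> C * N f"
    using dual_bounded[OF assms] by blast
  have "cmod (\<phi> f) \<le> C" if "f \<in> closed_unit_ball V N" for f
    using C(2)[of f] mult_left_mono[of "N f" 1 C] C(1) that by (simp add: closed_unit_ball_def)
  then show ?thesis by (rule bdd_aboveI2)
qed

lemma zero_in_ball: "0 \<in> closed_unit_ball V N"
  using nspace_zero_mem nspace_norm_zero by (simp add: closed_unit_ball_def)

lemma dual_norm_nonneg:
  assumes "\<phi> \<in> dual_space V N" shows "0 \<le> dual_norm V N \<phi>"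
  unfolding dual_norm_def
  by (rule order_trans[OF _ cSUP_upper[OF zero_in_ball dual_norm_bdd[OF assms]]]) simp

lemma dual_norm_least:
  assumes "\<And>f. f \<in> closed_unit_ball V N \<Longrightarrow> cmod (\<phi> f) \<le> C"
  shows "dual_norm V N \<phi> \<le> C"
  unfolding dual_norm_def using zero_in_ball assms by (intro cSUP_least) auto

lemma dual_norm_bound:
  assumes \<phi>: "\<phi> \<in> dual_space V N" and f: "f \<in> V"
  shows "cmod (\<phi> f) \<le> dual_norm V N \<phi> * N f"
proof (cases "f = 0")
  case True
  then show ?thesis using dual_zero[OF \<phi>] nspace_norm_zero by simp
next
  case False
  then have pos: "N f > 0" using nspace_norm_nonneg[OF f] nspace_norm_eq_zero[OF f] by simp
  let ?u = "of_real (1 / N f) *\<^sub>F f"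
  have "?u \<in> closed_unit_ball V N"
    using f pos complex_fun.subspace_scale[OF nspace_subspace f]
      nspace_norm_scale[OF f, of "of_real (1 / N f)"]
    by (simp add: closed_unit_ball_def norm_divide)
  then have "cmod (\<phi> ?u) \<le> dual_norm V N \<phi>"
    unfolding dual_norm_def by (intro cSUP_upper dual_norm_bdd[OF \<phi>])
  then show ?thesis using dual_scale[OF \<phi> f] pos by (simp add: norm_mult norm_divide field_simps)
qed

text \<open>
  The bidual is the dual of the dual, so this is what allows the lemmas of this section to be
  applied a second time.
\<close>

lemma normed_space_on_dual: "normed_space_on (dual_space V N) (dual_norm V N)"
proof -
  have zero: "0 \<in> dual_space V N"
    by (rule dual_intro[where C = 0]) auto
  have plus: "\<phi> + \<psi> \<in> dual_space V N" if \<phi>: "\<phi> \<in> dual_space V N" and \<psi>: "\<psi> \<in> dual_space V N" for \<phi> \<psi>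
  proof (rule dual_intro)
    fix f assume f: "f \<in> V"
    show "cmod ((\<phi> + \<psi>) f) \<le> (dual_norm V N \<phi> + dual_norm V N \<psi>) * N f"
      using dual_norm_bound[OF \<phi> f] dual_norm_bound[OF \<psi> f] norm_triangle_ineq[of "\<phi> f" "\<psi> f"]
      by (simp add: algebra_simps)
  qed (use that in \<open>simp_all add: dual_add dual_scale dual_off algebra_simps\<close>)
  have scale: "c *\<^sub>F \<phi> \<in> dual_space V N" if \<phi>: "\<phi> \<in> dual_space V N" for c \<phi>
  proof (rule dual_intro)
    fix f assume f: "f \<in> V"
    show "cmod ((c *\<^sub>F \<phi>) f) \<le> (cmod c * dual_norm V N \<phi>) * N f"
      using mult_left_mono[OF dual_norm_bound[OF \<phi> f], of "cmod c"]
      by (simp add: scaleF_def norm_mult mult.assoc)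
  qed (use that in \<open>simp_all add: dual_add dual_scale dual_off scaleF_apply algebra_simps\<close>)
  have le_scale: "dual_norm V N (c *\<^sub>F \<phi>) \<le> cmod c * dual_norm V N \<phi>"
    if \<phi>: "\<phi> \<in> dual_space V N" for c \<phi>
  proof (rule dual_norm_least)
    fix f assume "f \<in> closed_unit_ball V N"
    then have "cmod (\<phi> f) \<le> dual_norm V N \<phi>"
      unfolding dual_norm_def by (intro cSUP_upper dual_norm_bdd[OF \<phi>])
    then show "cmod ((c *\<^sub>F \<phi>) f) \<le> cmod c * dual_norm V N \<phi>"
      by (simp add: scaleF_def norm_mult mult_left_mono)
  qed
  \<comment> \<open>the reverse inequality is \<open>le_scale\<close> for the scalar \<open>inverse c\<close>\<close>
  have norm_scale': "dual_norm V N (c *\<^sub>F \<phi>) = cmod c * dual_norm V N \<phi>"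
    if \<phi>: "\<phi> \<in> dual_space V N" for c \<phi>
  proof (cases "c = 0")
    case True
    then show ?thesis
      using le_scale[OF \<phi>, of 0] dual_norm_nonneg[OF scale[OF \<phi>], of 0] by simp
  next
    case False
    have "inverse c *\<^sub>F c *\<^sub>F \<phi> = \<phi>" using False by (simp add: scaleF_def fun_eq_iff)
    then have "dual_norm V N \<phi> \<le> inverse (cmod c) * dual_norm V N (c *\<^sub>F \<phi>)"
      using le_scale[OF scale[OF \<phi>], of "inverse c" c] by (simp add: norm_inverse)
    then show ?thesis using le_scale[OF \<phi>, of c] False by (simp add: field_simps)
  qed
  have "dual_norm V N \<phi> = 0 \<longleftrightarrow> \<phi> = 0" if \<phi>: "\<phi> \<in> dual_space V N" for \<phi>
  proof
    assume "dual_norm V N \<phi> = 0"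
    then have "\<phi> f = 0" for f
      using dual_norm_bound[OF \<phi>, of f] dual_off[OF \<phi>, of f] by (cases "f \<in> V") auto
    then show "\<phi> = 0" by (simp add: fun_eq_iff)
  next
    assume "\<phi> = 0"
    then have "dual_norm V N \<phi> \<le> 0" by (intro dual_norm_least) simp
    then show "dual_norm V N \<phi> = 0" using dual_norm_nonneg[OF \<phi>] by simp
  qed
  moreover have "dual_norm V N (\<phi> + \<psi>) \<le> dual_norm V N \<phi> + dual_norm V N \<psi>"
    if \<phi>: "\<phi> \<in> dual_space V N" and \<psi>: "\<psi> \<in> dual_space V N" for \<phi> \<psi>
  proof (rule dual_norm_least)
    fix f assume f: "f \<in> closed_unit_ball V N"
    have "cmod (\<phi> f) \<le> dual_norm V N \<phi>" "cmod (\<psi> f) \<le> dual_norm V N \<psi>"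
      unfolding dual_norm_def using f that by (auto intro!: cSUP_upper dual_norm_bdd)
    then show "cmod ((\<phi> + \<psi>) f) \<le> dual_norm V N \<phi> + dual_norm V N \<psi>"
      using norm_triangle_ineq[of "\<phi> f" "\<psi> f"] by simp
  qed
  ultimately show ?thesis
    using zero plus scale norm_scale' dual_norm_nonneg
    by (auto simp: normed_space_on_def complex_fun.subspace_def)
qed

end

lemma continuous_map_complex_mult_left:
  fixes f :: "'b \<Rightarrow> complex"
  shows "continuous_map T euclidean f \<Longrightarrow> continuous_map T euclidean (\<lambda>x. c * f x)"
  by (simp add: continuous_map_atin tendsto_mult)

text \<open>
  This is the Banach--Alaoglu argument in the bidual, reduced to one sequence. By Tychonoff's
  theorem the images of the sequence in the bidual, seen as functions on the dual, have a
  pointwise cluster point. Additivity and homogeneity hold for every member of the sequence, and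
  each instance compares the values at finitely many functionals, hence is inherited by the
  cluster point. The latter thus belongs to the bidual, and reflexivity turns it into an element
  of the space.
\<close>

lemma reflexive_bounded_sequence_cluster_point:
  assumes V: "normed_space_on V N" and refl: "reflexive_space V N"
    and a: "\<And>n. a n \<in> V" "\<And>n. N (a n) \<le> R"
  obtains g where "g \<in> V"
    "\<And>\<phi> L. \<phi> \<in> dual_space V N \<Longrightarrow> (\<lambda>n. \<phi> (a n)) \<longlonglongrightarrow> L \<Longrightarrow> \<phi> g = L"
proof -
  let ?V' = "dual_space V N" and ?N' = "dual_norm V N"
  define \<iota> where "\<iota> n = canonical_embedding V N (a n)" for n
  \<comment> \<open>radius \<open>0\<close> off the dual makes the cluster point vanish there, as elements of the bidual must\<close>
  define r where "r \<phi> = (if \<phi> \<in> ?V' then R * ?N' \<phi> else 0)" for \<phi>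
  define K where "K = PiE UNIV (\<lambda>\<phi>. cball (0::complex) (r \<phi>))"
  let ?T = "product_topology (\<lambda>_::('b \<Rightarrow> complex) \<Rightarrow> complex. euclidean :: complex topology) UNIV"
  have K: "compactin ?T K"
    by (simp add: K_def compactin_PiE)
  have V': "normed_space_on ?V' ?N'" using V by (rule normed_space_on_dual)
  have "cmod (\<phi> (a n)) \<le> R * ?N' \<phi>" if \<phi>: "\<phi> \<in> ?V'" for \<phi> n
    using dual_norm_bound[OF V \<phi> a(1)[of n]]
      mult_left_mono[OF a(2)[of n] nspace_norm_nonneg[OF V' \<phi>]] by (simp add: mult.commute)
  then have \<iota>: "\<iota> n \<in> K" for n
    by (auto simp: K_def r_def \<iota>_def canonical_embedding_def)
  have \<iota>_eval: "\<iota> n \<phi> = \<phi> (a n)" if "\<phi> \<in> ?V'" for n \<phi>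
    using that by (simp add: \<iota>_def canonical_embedding_def)
  obtain \<Phi> where \<Phi>K: "\<Phi> \<in> K" and \<Phi>: "\<And>e L. continuous_map ?T euclidean e \<Longrightarrow>
      (\<lambda>n. e (\<iota> n)) \<longlonglongrightarrow> L \<Longrightarrow> e \<Phi> = (L :: complex)"
    by (rule compactin_sequence_cluster_point[OF K \<iota>, where 'c = complex]) (rule that)
  have coord: "continuous_map ?T euclidean (\<lambda>\<Psi>. \<Psi> \<phi>)" for \<phi>
    by (rule continuous_map_product_projection) simp
  have "\<Phi> \<in> bidual_space V N"
    unfolding bidual_space_def
  proof (rule dual_intro[OF V'])
    fix \<phi> \<psi> assume *: "\<phi> \<in> ?V'" "\<psi> \<in> ?V'"
    have sum: "\<phi> + \<psi> \<in> ?V'"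
      using nspace_subspace[OF V'] * by (rule complex_fun.subspace_add)
    have "(\<lambda>\<Psi>. \<Psi> (\<phi> + \<psi>) - (\<Psi> \<phi> + \<Psi> \<psi>)) \<Phi> = (0::complex)"
    proof (rule \<Phi>)
      show "continuous_map ?T euclidean (\<lambda>\<Psi>. \<Psi> (\<phi> + \<psi>) - (\<Psi> \<phi> + \<Psi> \<psi>))"
        by (intro continuous_map_diff continuous_map_add coord)
    qed (simp only: \<iota>_eval[OF *(1)] \<iota>_eval[OF *(2)] \<iota>_eval[OF sum], simp)
    then show "\<Phi> (\<phi> + \<psi>) = \<Phi> \<phi> + \<Phi> \<psi>" by simp
  next
    fix c \<phi> assume *: "\<phi> \<in> ?V'"
    have scale: "c *\<^sub>F \<phi> \<in> ?V'"
      using nspace_subspace[OF V'] * by (rule complex_fun.subspace_scale)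
    have "(\<lambda>\<Psi>. \<Psi> (c *\<^sub>F \<phi>) - c * \<Psi> \<phi>) \<Phi> = (0::complex)"
    proof (rule \<Phi>)
      show "continuous_map ?T euclidean (\<lambda>\<Psi>. \<Psi> (c *\<^sub>F \<phi>) - c * \<Psi> \<phi>)"
        by (intro continuous_map_diff continuous_map_complex_mult_left coord)
    qed (simp only: \<iota>_eval[OF *] \<iota>_eval[OF scale], simp add: scaleF_apply)
    then show "\<Phi> (c *\<^sub>F \<phi>) = c * \<Phi> \<phi>" by simp
  next
    fix \<phi>
    have "cmod (\<Phi> \<phi>) \<le> r \<phi>"
      using \<Phi>K unfolding K_def by (auto simp: PiE_iff)
    then show "\<phi> \<notin> ?V' \<Longrightarrow> \<Phi> \<phi> = 0" "\<phi> \<in> ?V' \<Longrightarrow> cmod (\<Phi> \<phi>) \<le> R * ?N' \<phi>"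
      by (simp_all add: r_def)
  qed
  then obtain g where g: "g \<in> V" "\<Phi> = canonical_embedding V N g"
    using refl unfolding reflexive_space_def by blast
  show thesis
  proof (rule that[OF g(1)])
    fix \<phi> L assume "\<phi> \<in> ?V'" "(\<lambda>n. \<phi> (a n)) \<longlonglongrightarrow> L"
    then show "\<phi> g = L"
      using \<Phi>[OF coord, of \<phi> L] by (simp add: \<iota>_def g(2) canonical_embedding_def)
  qed
qed

section \<open>Point evaluations\<close>

lemma continuous_map_evaluation_compact_open:
  "continuous_map compact_open_topology euclidean (\<lambda>f. f x)"
proof -
  have "openin compact_open_topology {f \<in> continuous_functions. f x \<in> U}" if "open U" for U :: "complex set"
    unfolding compact_open_topology_def
    using that by (intro topology_generated_by_Basis CollectI exI[of _ "{x}"] exI[of _ U]) auto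
  then show ?thesis by (auto simp: continuous_map_def)
qed

text \<open>
  Elements of a continuous dual vanish off the space, so evaluation at a point has to be cut off
  to become one.
\<close>

definition evaluation :: "('a \<Rightarrow> complex) set \<Rightarrow> 'a \<Rightarrow> ('a \<Rightarrow> complex) \<Rightarrow> complex"
  where "evaluation V x = (\<lambda>f. if f \<in> V then f x else 0)"

lemma evaluation_in_dual_continuous_functions:
  "evaluation continuous_functions x \<in> continuous_dual compact_open_topology"
proof -
  have "continuous_map compact_open_topology euclidean (evaluation continuous_functions x)"
    by (rule continuous_map_eq[OF continuous_map_evaluation_compact_open]) (simp add: evaluation_def)
  moreover have "f + g \<in> continuous_functions" "c *\<^sub>F f \<in> continuous_functions"
    if "f \<in> continuous_functions" "g \<in> continuous_functions" for f g :: "'a \<Rightarrow> complex" and c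
    using that by (auto simp: continuous_functions_def scaleF_def plus_fun_def intro!: continuous_intros)
  ultimately show ?thesis
    by (auto simp: continuous_dual_def linear_on_def evaluation_def scaleF_def)
qed

lemma evaluation_in_dual_nscf:
  assumes F: "nscf F N" shows "evaluation F x \<in> dual_space F N"
proof -
  have V: "normed_space_on F N" and emb: "continuous_map (norm_topology F N) compact_open_topology (\<lambda>f. f)"
    using F by (simp_all add: nscf_def)
  have "continuous_map (norm_topology F N) euclidean (\<lambda>f. f x)"
    using continuous_map_compose[OF emb continuous_map_evaluation_compact_open] by (simp add: o_def)
  then have "continuous_map (norm_topology F N) euclidean (evaluation F x)"
    by (rule continuous_map_eq) (simp add: evaluation_def V)
  then show ?thesis
    using nspace_subspace[OF V]
    by (auto simp: dual_space_def continuous_dual_def linear_on_def evaluation_def scaleF_def V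
        complex_fun.subspace_def)
qed

lemma continuous_map_weak_topology:
  assumes "\<phi> \<in> continuous_dual T"
  shows "continuous_map (weak_topology T) euclidean \<phi>"
proof -
  have "openin (weak_topology T) {f \<in> topspace T. \<phi> f \<in> U}" if "open U" for U
    unfolding weak_topology_def using that assms by (intro topology_generated_by_Basis) blast
  then show ?thesis by (auto simp: continuous_map_def)
qed

lemma continuous_map_evaluation_weak:
  "continuous_map (weak_topology compact_open_topology) euclidean (\<lambda>f. f x)"
  by (rule continuous_map_eq[OF continuous_map_weak_topology[OF evaluation_in_dual_continuous_functions]])
    (simp add: evaluation_def)

section \<open>Ergodic averages\<close>

definition ergodic_average :: "('a \<Rightarrow> complex) \<Rightarrow> ('a \<Rightarrow> complex) \<Rightarrow> nat \<Rightarrow> 'a \<Rightarrow> complex"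
  where "ergodic_average \<zeta> f n = (\<lambda>x. (\<Sum>k<Suc n. \<zeta> x ^ k) / of_nat (Suc n) * f x)"

text \<open>
  Off the set \<open>{\<zeta> = 1}\<close> the geometric sums stay bounded by \<open>2 / \<bar>\<zeta> x - 1\<bar>\<close>, so the averages tend
  to \<open>0\<close>; on that set they are constant.
\<close>

lemma ergodic_average_tendsto:
  assumes "cmod (\<zeta> x) = 1"
  shows "(\<lambda>n. ergodic_average \<zeta> f n x) \<longlonglongrightarrow> (if \<zeta> x = 1 then f x else 0)"
proof (cases "\<zeta> x = 1")
  case True
  then have "ergodic_average \<zeta> f n x = f x" for n
    by (simp add: ergodic_average_def del: of_nat_Suc sum.lessThan_Suc)
  then show ?thesis using True by simp
next
  case False
  have bound: "cmod (ergodic_average \<zeta> f n x) \<le> 2 / cmod (\<zeta> x - 1) * cmod (f x) / real (Suc n)" for n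
  proof -
    have "cmod (\<zeta> x ^ Suc n - 1) \<le> 2"
      using norm_triangle_ineq4[of "\<zeta> x ^ Suc n" 1] assms by (simp add: norm_power norm_mult)
    then have "cmod (\<Sum>k<Suc n. \<zeta> x ^ k) \<le> 2 / cmod (\<zeta> x - 1)"
      using False geometric_sum[OF False, of "Suc n"]
      by (simp add: norm_divide divide_right_mono del: sum.lessThan_Suc power_Suc)
    then have "cmod (\<Sum>k<Suc n. \<zeta> x ^ k) * (cmod (f x) / real (Suc n))
        \<le> 2 / cmod (\<zeta> x - 1) * (cmod (f x) / real (Suc n))"
      by (rule mult_right_mono) simp
    then show ?thesis
      by (simp add: ergodic_average_def norm_mult norm_divide del: sum.lessThan_Suc of_nat_Suc)
  qed
  have "(\<lambda>n. 2 / cmod (\<zeta> x - 1) * cmod (f x) / real (Suc n)) \<longlonglongrightarrow> 0"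
    by (rule LIMSEQ_Suc[OF lim_const_over_n])
  then have "(\<lambda>n. ergodic_average \<zeta> f n x) \<longlonglongrightarrow> 0"
    by (rule Lim_null_comparison[rotated]) (use bound in auto)
  then show ?thesis using False by simp
qed

lemma ergodic_average_in_ball:
  assumes V: "normed_space_on F N"
    and \<zeta>: "\<And>f. f \<in> F \<Longrightarrow> mult_op \<zeta> f \<in> F" "\<And>f. f \<in> F \<Longrightarrow> N (mult_op \<zeta> f) = N f"
    and f: "f \<in> F"
  shows "ergodic_average \<zeta> f n \<in> F" "N (ergodic_average \<zeta> f n) \<le> N f"
proof -
  have power: "(\<lambda>x. \<zeta> x ^ k * f x) \<in> F \<and> N (\<lambda>x. \<zeta> x ^ k * f x) = N f" for k
  proof (induction k)
    case 0
    then show ?case using f by simp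
  next
    case (Suc k)
    have "(\<lambda>x. \<zeta> x ^ Suc k * f x) = mult_op \<zeta> (\<lambda>x. \<zeta> x ^ k * f x)"
      by (simp add: mult_op_def mult.assoc)
    then show ?case using Suc \<zeta> by metis
  qed
  have sum: "(\<lambda>x. (\<Sum>k<m. \<zeta> x ^ k) * f x) \<in> F \<and> N (\<lambda>x. (\<Sum>k<m. \<zeta> x ^ k) * f x) \<le> real m * N f" for m
  proof (induction m)
    case 0
    then show ?case using nspace_zero_mem[OF V] nspace_norm_zero[OF V] by (simp add: zero_fun_def)
  next
    case (Suc m)
    have eq: "(\<lambda>x. (\<Sum>k<Suc m. \<zeta> x ^ k) * f x)
        = (\<lambda>x. (\<Sum>k<m. \<zeta> x ^ k) * f x) + (\<lambda>x. \<zeta> x ^ m * f x)"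
      by (simp add: plus_fun_def algebra_simps)
    show ?case
      unfolding eq using Suc power[of m] complex_fun.subspace_add[OF nspace_subspace[OF V]]
        nspace_norm_triangle[OF V, of "\<lambda>x. (\<Sum>k<m. \<zeta> x ^ k) * f x" "\<lambda>x. \<zeta> x ^ m * f x"]
      by (simp add: algebra_simps)
  qed
  define s where "s = (\<lambda>x. (\<Sum>k<Suc n. \<zeta> x ^ k) * f x)"
  have s: "s \<in> F" "N s \<le> real (Suc n) * N f" using sum[of "Suc n"] by (simp_all add: s_def)
  have eq: "ergodic_average \<zeta> f n = (1 / of_nat (Suc n)) *\<^sub>F s"
    by (simp add: ergodic_average_def scaleF_def s_def)
  show "ergodic_average \<zeta> f n \<in> F"
    unfolding eq using nspace_subspace[OF V] s(1) by (rule complex_fun.subspace_scale)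
  show "N (ergodic_average \<zeta> f n) \<le> N f"
    unfolding eq using nspace_norm_scale[OF V s(1), of "1 / of_nat (Suc n)"] s(2)
    by (simp add: norm_divide pos_divide_le_eq mult.commute del: of_nat_Suc)
qed

section \<open>Unitary multiplication operators\<close>

text \<open>
  Since \<open>\<bar>f x\<bar>\<close> is bounded by a multiple of the norm, isometry bounds \<open>\<bar>\<omega> x\<bar>\<^sup>n \<bar>f x\<bar>\<close> uniformly in
  \<open>n\<close>, so that \<open>\<bar>\<omega> x\<bar> \<le> 1\<close>. Surjectivity gives the same bound for preimages under the powers
  of the operator, which excludes \<open>\<bar>\<omega> x\<bar> < 1\<close>.
\<close>

lemma unitary_multiplier_unimodular:
  assumes F: "nscf F N" and ind: "one_independent F" and U: "unitary_on F N (mult_op \<omega>)"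
  shows "cmod (\<omega> x) = 1"
proof -
  have V: "normed_space_on F N" using F by (simp add: nscf_def)
  have img: "mult_op \<omega> ` F = F" and iso: "\<And>f. f \<in> F \<Longrightarrow> N (mult_op \<omega> f) = N f"
    using U by (simp_all add: unitary_on_def)
  obtain C where C: "C \<ge> 0" "\<And>f. f \<in> F \<Longrightarrow> cmod (f x) \<le> C * N f"
    using dual_bounded[OF V evaluation_in_dual_nscf[OF F, of x]] by (auto simp: evaluation_def)
  obtain f where f: "f \<in> F" "f x \<noteq> 0" using ind unfolding one_independent_def by blast
  have fwd: "\<exists>g\<in>F. N g = N f \<and> g x = \<omega> x ^ n * f x" for n
  proof (induction n)
    case 0
    then show ?case using f by auto
  next
    case (Suc n)
    then obtain g where "g \<in> F" "N g = N f" "g x = \<omega> x ^ n * f x" by blast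
    then show ?case using img iso[of g] by (intro bexI[of _ "mult_op \<omega> g"]) (auto simp: mult_op_def)
  qed
  have bwd: "\<exists>g\<in>F. N g = N f \<and> f x = \<omega> x ^ n * g x" for n
  proof (induction n)
    case 0
    then show ?case using f by auto
  next
    case (Suc n)
    then obtain g where g: "g \<in> F" "N g = N f" "f x = \<omega> x ^ n * g x" by blast
    then obtain h where "h \<in> F" "g = mult_op \<omega> h" using img by blast
    then show ?case using g iso[of h] by (intro bexI[of _ h]) (auto simp: mult_op_def)
  qed
  have "\<not> cmod (\<omega> x) > 1"
  proof
    assume "cmod (\<omega> x) > 1"
    then obtain n where n: "C * N f / cmod (f x) < cmod (\<omega> x) ^ n"
      using real_arch_pow by blast
    obtain g where "g \<in> F" "N g = N f" "g x = \<omega> x ^ n * f x" using fwd by blast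
    then have "cmod (\<omega> x) ^ n * cmod (f x) \<le> C * N f"
      using C(2)[of g] by (simp add: norm_mult norm_power)
    then show False using n f(2) by (simp add: field_simps)
  qed
  moreover have "\<not> cmod (\<omega> x) < 1"
  proof
    assume *: "cmod (\<omega> x) < 1"
    have "(\<lambda>n. cmod (\<omega> x) ^ n * (C * N f)) \<longlonglongrightarrow> 0 * (C * N f)"
      using * by (intro tendsto_mult_right LIMSEQ_realpow_zero) auto
    moreover have "cmod (f x) \<le> cmod (\<omega> x) ^ n * (C * N f)" for n
    proof -
      obtain g where g: "g \<in> F" "N g = N f" "f x = \<omega> x ^ n * g x" using bwd by blast
      then show ?thesis using mult_left_mono[OF C(2)[OF g(1)], of "cmod (\<omega> x) ^ n"]
        by (simp add: norm_mult norm_power)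
    qed
    ultimately have "cmod (f x) \<le> 0"
      by (intro LIMSEQ_le_const[of _ "0 :: real"]) auto
    then show False using f(2) by simp
  qed
  ultimately show ?thesis by simp
qed

text \<open>
  The only place where the compactness hypotheses enter: the pointwise limit of a norm-bounded
  sequence agrees at every point with a cluster point, and cluster points are continuous
  functions.
\<close>

lemma continuous_cluster_point:
  assumes F: "nscf F N"
    and comp: "compactly_embedded F N \<or> weakly_compactly_embedded F N \<or> reflexive_space F N"
    and a: "\<And>n. a n \<in> F" "\<And>n. N (a n) \<le> R"
    and lim: "\<And>x. (\<lambda>n. a n x) \<longlonglongrightarrow> h x"
  shows "continuous_on UNIV h"
proof -
  have V: "normed_space_on F N" and FC: "F \<subseteq> continuous_functions" using F by (simp_all add: nscf_def)
  have embedded: "continuous_on UNIV h"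
    if rc: "relatively_compact_in T (open_unit_ball F N)"
      and T: "topspace T = continuous_functions" and ev: "\<And>x. continuous_map T euclidean (\<lambda>f. f x)" for T
  proof -
    \<comment> \<open>the embedding hypotheses concern the open unit ball, so the sequence is shrunk into it\<close>
    define c where "c = 1 / (\<bar>R\<bar> + 1)"
    have c: "c > 0" "c * \<bar>R\<bar> < 1" by (simp_all add: c_def)
    have N_ball: "N (of_real c *\<^sub>F a n) < 1" for n
    proof -
      have "c * N (a n) \<le> c * \<bar>R\<bar>" using a(2)[of n] c(1) by (intro mult_left_mono) auto
      also have "\<dots> < 1" by (rule c(2))
      finally show ?thesis using nspace_norm_scale[OF V a(1), of "of_real c" n] c(1) by simp
    qed
    have ball: "of_real c *\<^sub>F a n \<in> open_unit_ball F N" for n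
      using N_ball complex_fun.subspace_scale[OF nspace_subspace[OF V] a(1)] by (simp add: open_unit_ball_def)
    have K: "compactin T (T closure_of open_unit_ball F N)"
      and sub: "open_unit_ball F N \<subseteq> topspace T"
      using rc by (simp_all add: relatively_compact_in_def)
    obtain g where g: "g \<in> T closure_of open_unit_ball F N" and
      g_lim: "\<And>e L. continuous_map T euclidean e \<Longrightarrow>
        (\<lambda>n. e (of_real c *\<^sub>F a n)) \<longlonglongrightarrow> L \<Longrightarrow> e g = (L :: complex)"
      by (rule compactin_sequence_cluster_point[OF K subsetD[OF closure_of_subset[OF sub] ball],
            where 'c = complex]) (rule that)
    have "g x = of_real c * h x" for x
      using g_lim[OF ev[of x], of "of_real c * h x"] lim[of x]
      by (simp add: scaleF_def tendsto_mult_left)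
    then have h: "h = (\<lambda>x. g x / of_real c)" using c(1) by (simp add: fun_eq_iff)
    have "g \<in> continuous_functions" using g T by (metis in_closure_of)
    then show ?thesis using c(1) unfolding h continuous_functions_def
      by (auto intro!: continuous_intros)
  qed
  show ?thesis
    using comp
  proof (elim disjE)
    assume "compactly_embedded F N"
    then show ?thesis unfolding compactly_embedded_def
      by (rule embedded) (simp_all add: continuous_map_evaluation_compact_open)
  next
    assume "weakly_compactly_embedded F N"
    then show ?thesis unfolding weakly_compactly_embedded_def
      by (rule embedded) (simp_all add: continuous_map_evaluation_weak)
  next
    assume "reflexive_space F N"
    then obtain g where g: "g \<in> F" and
      g_lim: "\<And>\<phi> L. \<phi> \<in> dual_space F N \<Longrightarrow> (\<lambda>n. \<phi> (a n)) \<longlonglongrightarrow> L \<Longrightarrow> \<phi> g = L"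
      by (rule reflexive_bounded_sequence_cluster_point[OF V _ a]) (rule that)
    have "g x = h x" for x
      using g_lim[OF evaluation_in_dual_nscf[OF F, of x], of "h x"] lim[of x] g a(1)
      by (simp add: evaluation_def)
    then have "h = g" by (simp add: fun_eq_iff)
    then show ?thesis using g FC by (auto simp: continuous_functions_def)
  qed
qed

text \<open>
  With \<open>E = {\<omega> = \<omega> y}\<close>, cutting \<open>f \<in> F\<close> off outside \<open>E\<close> gives a continuous function. The set
  where it is nonzero is an open part of \<open>E\<close>, the set where it differs from \<open>f\<close> an open part of
  the complement; as \<open>f\<close> varies, these parts exhaust \<open>E\<close> and its complement.
\<close>

lemma unitary_multiplier_constant:
  fixes F :: "('a::t2_space \<Rightarrow> complex) set"
  assumes conn: "connected (UNIV :: 'a set)"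
    and F: "nscf F N" and ind: "one_independent F" and U: "unitary_on F N (mult_op \<omega>)"
    and comp: "compactly_embedded F N \<or> weakly_compactly_embedded F N \<or> reflexive_space F N"
  shows "\<omega> x = \<omega> y"
proof -
  have V: "normed_space_on F N" and FC: "F \<subseteq> continuous_functions" using F by (simp_all add: nscf_def)
  have unimod: "cmod (\<omega> z) = 1" for z using F ind U by (rule unitary_multiplier_unimodular)
  define \<zeta> where "\<zeta> z = inverse (\<omega> y) * \<omega> z" for z
  have \<zeta>1: "\<zeta> z = 1 \<longleftrightarrow> \<omega> z = \<omega> y" for z
    using unimod[of y] by (auto simp: \<zeta>_def field_simps)
  have cmod_\<zeta>: "cmod (\<zeta> z) = 1" for z
    using unimod by (simp add: \<zeta>_def norm_mult norm_inverse)
  have mult_\<zeta>: "mult_op \<zeta> f = inverse (\<omega> y) *\<^sub>F mult_op \<omega> f" for f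
    by (simp add: mult_op_def \<zeta>_def scaleF_def mult.assoc)
  have \<omega>F: "mult_op \<omega> f \<in> F" "N (mult_op \<omega> f) = N f" if "f \<in> F" for f
    using U that by (auto simp: unitary_on_def)
  have \<zeta>F: "mult_op \<zeta> f \<in> F" "N (mult_op \<zeta> f) = N f" if "f \<in> F" for f
    unfolding mult_\<zeta> using \<omega>F[OF that] nspace_subspace[OF V] nspace_norm_scale[OF V] unimod[of y]
    by (simp_all add: complex_fun.subspace_scale norm_inverse)
  define E where "E = {z. \<omega> z = \<omega> y}"
  define cut where "cut f z = (if z \<in> E then f z else 0)" for f :: "'a \<Rightarrow> complex" and z
  have cont_cut: "continuous_on UNIV (cut f)" if f: "f \<in> F" for f
  proof (rule continuous_cluster_point[OF F comp])
    show "ergodic_average \<zeta> f n \<in> F" "N (ergodic_average \<zeta> f n) \<le> N f" for n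
      using ergodic_average_in_ball[OF V \<zeta>F f] by auto
    show "(\<lambda>n. ergodic_average \<zeta> f n z) \<longlonglongrightarrow> cut f z" for z
      using ergodic_average_tendsto[of \<zeta> z f] cmod_\<zeta> by (simp add: cut_def E_def \<zeta>1)
  qed
  have cont: "continuous_on UNIV f" if "f \<in> F" for f
    using that FC by (auto simp: continuous_functions_def)
  have "E = (\<Union>f\<in>F. {z. cut f z \<noteq> 0})"
    using ind by (auto simp: cut_def one_independent_def split: if_splits)
  moreover have "open (\<Union>f\<in>F. {z. cut f z \<noteq> 0})"
    using cont_cut by (intro open_UN ballI open_Collect_neq) auto
  ultimately have "open E" by simp
  moreover have "- E = (\<Union>f\<in>F. {z. f z \<noteq> cut f z})"
    using ind by (auto simp: cut_def one_independent_def split: if_splits)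
  moreover have "open (\<Union>f\<in>F. {z. f z \<noteq> cut f z})"
    using cont_cut cont by (intro open_UN ballI open_Collect_neq) auto
  ultimately have "open E" "closed E" by (simp_all add: closed_def)
  moreover have "y \<in> E" by (simp add: E_def)
  ultimately have "E = UNIV" using conn by (auto simp: connected_clopen)
  then show ?thesis by (auto simp: E_def)
qed

theorem theorem3p9:
  fixes F :: "('a::t2_space \<Rightarrow> complex) set"
    and N :: "('a \<Rightarrow> complex) \<Rightarrow> real"
    and \<omega> :: "'a \<Rightarrow> complex"
  assumes "connected (UNIV :: 'a set)"
    and "k_space (euclidean :: 'a topology)"
    and "nscf F N"
    and "one_independent F"
    and "unitary_on F N (mult_op \<omega>)"
    and "compactly_embedded F N
      \<or> (weakly_compactly_embedded F N \<and> nearly_strictly_convex F N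
          \<and> closedin compact_open_topology (closed_unit_ball F N))
      \<or> (weakly_compactly_embedded F N
          \<and> nearly_strictly_convex (bidual_space F N) (bidual_norm F N))
      \<or> (reflexive_space F N \<and> nearly_strictly_convex F N)"
  shows "\<exists>c::complex. cmod c = 1 \<and> (\<forall>x. \<omega> x = c)"
proof (intro exI conjI allI)
  show "cmod (\<omega> undefined) = 1"
    using assms(3-5) by (rule unitary_multiplier_unimodular)
  show "\<omega> x = \<omega> undefined" for x
    using assms(6) by (intro unitary_multiplier_constant[OF assms(1,3-5)]) blast
qed

end
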